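(* Let $m=n$ be prime, let $f:\mathbb{Z}_n\to\mathbb{Z}_n$ be an $m$-cycle (a permutation that is a single cycle of length $m=n$), let $r\geq 2$, let $i_1,\dots,i_r\in\mathbb{Z}_m$ be nonzero and pairwise different, and put $\mathcal{I}=\{0,i_1,\dots,i_r\}\subseteq\mathbb{Z}_m$. Let $$H=\begin{pmatrix}1&1&\cdots&1\\ 1&f^{i_1}&\cdots&f^{i_r}\end{pmatrix}.$$ If $\mathcal{I}$ is an $m$-$B_2$-set, then $g(H)=12$.
   Context: $\mathbb{Z}_n$ denotes the integers modulo $n$. A permutation $R$ of $\mathbb{Z}_n$ is identified with the $n\times n$ $0/1$ permutation matrix having entry $1$ at position $(a,c)$ iff $a=R(c)$; $1$ denotes the identity permutation (matrix). An array of permutations denotes the corresponding block matrix. Exponents of $f$ are taken modulo $m$. A set $\mathcal{I}\subseteq\mathbb{Z}_m$ is an $m$-$B_2$-set if for $p,q,s,t\in\mathcal{I}$ one has $p+q=s+t$ in $\mathbb{Z}_m$ iff $\{p,q\}=\{s,t\}$. Cycles in the matrix: a $2k$-cycle in $H$ ($k>1$) is a closed sequence of positions $(x_0,y_0),(x_1,y_0),(x_1,y_1),\dots,(x_{k-1},y_{k-1}),(x_0,y_{k-1}),(x_0,y_0)$ of $H$, obtained by alternately changing only the row or only the column, such that all these entries of $H$ equal $1$ and the $2k$ positions (other than the repeated first/last one) are pairwise distinct. The girth $g(H)$ is the smallest even integer $2k$, $k>1$, such that $H$ contains a $2k$-cycle. *)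

theory Defs
  imports
    "HOL-Number_Theory.Cong"
    "HOL-Computational_Algebra.Primes"
    "HOL-Combinatorics.Orbits"
    "HOL-Library.Extended_Nat"
    "Jordan_Normal_Form.Matrix"
begin

(* The ring of integers modulo n is represented by the residues 0, ..., n - 1 of type nat. *)

definition B2_set :: "nat \<Rightarrow> nat set \<Rightarrow> bool" where
  "B2_set m I \<longleftrightarrow> I \<subseteq> {0..<m} \<and>
     (\<forall>p\<in>I. \<forall>q\<in>I. \<forall>s\<in>I. \<forall>t\<in>I. [p + q = s + t] (mod m) \<longleftrightarrow> {p, q} = {s, t})"

definition perm_matrix :: "nat \<Rightarrow> (nat \<Rightarrow> nat) \<Rightarrow> nat mat" where
  "perm_matrix n R = mat n n (\<lambda>(a, c). if a = R c then 1 else 0)"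

(* The J x L block matrix whose (u, v) block is the permutation matrix of R u v
   (blocks are indexed from 0): row u * n + a with a < n is row a of block row u,
   and similarly for columns. *)

definition perm_array_matrix ::
    "nat \<Rightarrow> nat \<Rightarrow> nat \<Rightarrow> (nat \<Rightarrow> nat \<Rightarrow> nat \<Rightarrow> nat) \<Rightarrow> nat mat" where
  "perm_array_matrix n J L R = mat (J * n) (L * n)
     (\<lambda>(x, y). perm_matrix n (R (x div n) (y div n)) $$ (x mod n, y mod n))"

(* The 2 x (r + 1) array whose first row and first column consist of identities and
   whose second row continues with f^(i 1), ..., f^(i r). *)

definition two_row_matrix :: "nat \<Rightarrow> (nat \<Rightarrow> nat) \<Rightarrow> nat \<Rightarrow> (nat \<Rightarrow> nat) \<Rightarrow> nat mat" where
  "two_row_matrix n f r i = perm_array_matrix n 2 (r + 1)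
     (\<lambda>u v. if u = 0 \<or> v = 0 then id else f ^^ i v)"

(* (x 0, y 0), (x 1, y 0), (x 1, y 1), ..., (x (k-1), y (k-1)), (x 0, y (k-1));
   the final return to (x 0, y 0) is left out. *)

definition cycle_positions ::
    "nat \<Rightarrow> (nat \<Rightarrow> nat) \<Rightarrow> (nat \<Rightarrow> nat) \<Rightarrow> (nat \<times> nat) list" where
  "cycle_positions k x y = concat (map (\<lambda>j. [(x j, y j), (x (Suc j mod k), y j)]) [0..<k])"

(* Distinctness of the positions forces every step to change the row or column. *)

definition has_cycle :: "'a::one mat \<Rightarrow> nat \<Rightarrow> bool" where
  "has_cycle H k \<longleftrightarrow> k > 1 \<and>
     (\<exists>x y. distinct (cycle_positions k x y) \<and>
       (\<forall>(a, b) \<in> set (cycle_positions k x y).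
          a < dim_row H \<and> b < dim_col H \<and> H $$ (a, b) = 1))"

(* The girth is \<infinity> if there are no cycles. *)

definition girth :: "'a::one mat \<Rightarrow> enat" where
  "girth H = Inf {enat (2 * k) | k. has_cycle H k}"

end

theory Submission
  imports Defs
begin

text \<open>
  Every column of the matrix contains exactly two ones, one in each block row. Numbering
  \<open>{0..<n}\<close> along the cycle \<open>f\<close> turns the columns into edges \<open>s \<rightarrow> s + e\<close>, with \<open>e\<close> in the
  given set, of a bipartite graph on two copies of the integers modulo \<open>n\<close>, and a
  \<open>2k\<close>-cycle of the matrix into a closed walk of length \<open>k\<close> without backtracking. Hence
  \<open>k\<close> is even; \<open>k = 2\<close> would be a double edge, and \<open>k = 4\<close> would give
  \<open>p\<^sub>0 + p\<^sub>2 = p\<^sub>1 + p\<^sub>3\<close> with \<open>p\<^sub>1\<close> different from \<open>p\<^sub>0\<close> and \<open>p\<^sub>2\<close>, which the \<open>B\<^sub>2\<close> property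
  forbids. By commutativity the hexagon \<open>a - b + c - a + b - c = 0\<close> always closes up.
\<close>

section \<open>Powers of a permutation that is a single cycle\<close>

lemma cyclic_on_funpow_eq_iff:
  assumes "cyclic_on f S" "x \<in> S"
  shows "(f ^^ a) x = (f ^^ b) x \<longleftrightarrow> [a = b] (mod card S)"
proof -
  have orb: "x \<in> orbit f x" "orbit f x = S"
    using assms by (auto simp: cyclic_on_alldef)
  \<comment> \<open>\<open>d\<close> is the first return time of \<open>x\<close>: the exponents
    below it list \<open>S\<close> without repetition, hence \<open>d = card S\<close>.\<close>
  define d where "d = funpow_dist1 f x x"
  have inj: "inj_on (\<lambda>k. (f ^^ k) x) {0..<d}"
    unfolding d_def by (rule inj_on_funpow_dist1[OF orb(1)])
  have "S = (\<lambda>k. (f ^^ k) x) ` {0..<d}"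
    using orbit_conv_funpow_dist1[OF orb(1)] orb(2) unfolding d_def by simp
  then have card: "card S = d"
    using card_image[OF inj] by simp
  have "(f ^^ d) x = x"
    unfolding d_def by (rule funpow_dist1_prop[OF orb(1)])
  then have "(f ^^ a) x = (f ^^ b) x \<longleftrightarrow> (f ^^ (a mod d)) x = (f ^^ (b mod d)) x"
    by (simp add: funpow_mod_eq)
  also have "\<dots> \<longleftrightarrow> a mod d = b mod d"
    using inj_on_eq_iff[OF inj, of "a mod d" "b mod d"] by (simp add: d_def)
  finally show ?thesis
    by (simp add: card cong_def)
qed

lemma cyclic_on_funpow_surj:
  assumes "cyclic_on f S" "x \<in> S" "y \<in> S"
  obtains k where "y = (f ^^ k) x"
  using assms by (auto simp: cyclic_on_alldef orbit_altdef)

text \<open>With \<open>b = (f ^^ k) a\<close>, both equations become congruences between exponents;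
  adding them cancels the unknown shift \<open>k\<close> and leaves \<open>p1 + p3 = p2 + p0\<close>
  modulo \<open>n\<close>, to which the \<open>B2_set\<close> property applies.\<close>

lemma B2_closed_walk_4:
  assumes "B2_set n I" "cyclic_on f {0..<n}"
    and p: "p0 \<in> I" "p1 \<in> I" "p2 \<in> I" "p3 \<in> I"
    and ab: "a < n" "b < n"
    and eq: "(f ^^ p1) a = (f ^^ p2) b" "(f ^^ p3) b = (f ^^ p0) a"
  shows "p0 = p1 \<or> p1 = p2 \<and> a = b"
proof -
  have a: "a \<in> {0..<n}" and b: "b \<in> {0..<n}"
    using ab by auto
  obtain k where k: "b = (f ^^ k) a"
    by (rule cyclic_on_funpow_surj[OF assms(2) a b])
  have "(f ^^ p1) a = (f ^^ (p2 + k)) a" "(f ^^ (p3 + k)) a = (f ^^ p0) a"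
    using eq by (simp_all add: k funpow_add)
  then have cong: "[p1 = p2 + k] (mod n)" "[p3 + k = p0] (mod n)"
    using cyclic_on_funpow_eq_iff[OF assms(2) a] by simp_all
  have "[p1 + (p3 + k) = (p2 + k) + p0] (mod n)"
    using cong by (rule cong_add)
  then have "[(p1 + p3) + k = (p2 + p0) + k] (mod n)"
    by (simp add: ac_simps)
  then have "[p1 + p3 = p2 + p0] (mod n)"
    by (simp only: cong_add_rcancel_nat)
  then have "{p1, p3} = {p2, p0}"
    using assms(1) p unfolding B2_set_def by blast
  then consider "p0 = p1" | "p1 = p2"
    by (auto simp: doubleton_eq_iff)
  then show ?thesis
  proof cases
    \<comment> \<open>Equal exponents force the shift \<open>k\<close> to vanish modulo
      \<open>n\<close>.\<close>
    case 2
    then have "[0 + p2 = k + p2] (mod n)"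
      using cong(1) by (simp add: ac_simps)
    then have "[0 = k] (mod n)"
      by (simp only: cong_add_rcancel_nat)
    then have "(f ^^ 0) a = (f ^^ k) a"
      using cyclic_on_funpow_eq_iff[OF assms(2) a, of 0 k] by simp
    then show ?thesis
      using 2 k by simp
  qed simp
qed

section \<open>Columns of the matrix as edges\<close>

lemma two_row_matrix_dims:
  "dim_row (two_row_matrix n f r i) = 2 * n"
  "dim_col (two_row_matrix n f r i) = (r + 1) * n"
  by (simp_all add: two_row_matrix_def perm_array_matrix_def)

lemma two_row_matrix_eq_1_iff:
  assumes "x < 2 * n" "y < (r + 1) * n"
  shows "two_row_matrix n f r i $$ (x, y) = 1 \<longleftrightarrow>
    x = y mod n \<or> x = n + (f ^^ (if y div n = 0 then 0 else i (y div n))) (y mod n)"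
proof -
  have n: "n > 0"
    using assms(1) by simp
  have *: "two_row_matrix n f r i $$ (x, y) = 1 \<longleftrightarrow>
     x mod n = (if x div n = 0 \<or> y div n = 0 then id else f ^^ i (y div n)) (y mod n)"
    using assms n by (simp add: two_row_matrix_def perm_array_matrix_def perm_matrix_def)
  have yn: "y mod n < n"
    using n by simp
  show ?thesis
  proof (cases "x < n")
    case True
    then show ?thesis
      by (simp add: * del: One_nat_def)
  next
    case False
    then have "x div n = 1" "x mod n = x - n"
      using assms(1) n by (auto simp: mod_if intro: div_nat_eqI)
    then show ?thesis
      using False yn by (auto simp: * simp del: One_nat_def)
  qed
qed

text \<open>\<open>e v\<close> is the exponent of block column \<open>v\<close>, and
  \<open>g y\<close> is the offset within the lower block row of the second one in column
  \<open>y\<close>. Column \<open>y\<close> is thus the edge from upper vertex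
  \<open>y mod n\<close> to lower vertex \<open>g y\<close>.\<close>

context
  fixes n r :: nat and f i e g :: "nat \<Rightarrow> nat"
  assumes e_def: "\<And>v. e v = (if v = 0 then 0 else i v)"
    and g_def: "\<And>y. g y = (f ^^ e (y div n)) (y mod n)"
    and cyc: "cyclic_on f {0..<n}"
    and inj: "inj_on e {..r}"
    and B2: "B2_set n (e ` {..r})"
begin

lemma one_in_column_iff:
  assumes "x < 2 * n" "y < (r + 1) * n"
  shows "two_row_matrix n f r i $$ (x, y) = 1 \<longleftrightarrow> x = y mod n \<or> x = n + g y"
  using two_row_matrix_eq_1_iff[OF assms] unfolding e_def g_def .

lemma column_eqI:
  assumes "y < (r + 1) * n" "z < (r + 1) * n"
    and "y mod n = z mod n" "e (y div n) = e (z div n)"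
  shows "y = z"
proof -
  have "y div n < r + 1" "z div n < r + 1"
    using assms(1,2) by (auto intro: less_mult_imp_div_less)
  then have "y div n \<in> {..r}" "z div n \<in> {..r}"
    by simp_all
  then have "y div n = z div n"
    using inj assms(4) by (auto dest: inj_onD)
  then show ?thesis
    using assms(3) by (metis div_mult_mod_eq)
qed

lemma column_exponent:
  assumes "y < (r + 1) * n"
  shows "e (y div n) \<in> e ` {..r}"
proof -
  have "y div n < r + 1"
    using assms by (rule less_mult_imp_div_less)
  then show ?thesis
    by simp
qed

text \<open>Equal ends make the exponents congruent modulo \<open>n\<close>; as members of a
  \<open>B2_set\<close> they are residues below \<open>n\<close>, hence equal.\<close>

lemma columns_no_double_edge:
  assumes "y < (r + 1) * n" "z < (r + 1) * n" "y mod n = z mod n" "g y = g z"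
  shows "y = z"
proof -
  have "y mod n \<in> {0..<n}"
    using assms(1) by (cases "n = 0") auto
  then have "[e (y div n) = e (z div n)] (mod n)"
    using assms(3,4) cyclic_on_funpow_eq_iff[OF cyc, of "y mod n"] by (simp add: g_def)
  moreover have "e (y div n) \<in> {0..<n}" "e (z div n) \<in> {0..<n}"
    using column_exponent[OF assms(1)] column_exponent[OF assms(2)] B2
    unfolding B2_set_def by blast+
  ultimately have "e (y div n) = e (z div n)"
    by (simp add: cong_def)
  then show ?thesis
    by (rule column_eqI[OF assms(1-3)])
qed

text \<open>A closed walk of four edges that starts at a lower vertex must backtrack at one of its
  first two turns.\<close>

lemma columns_no_4_cycle:
  assumes "z0 < (r + 1) * n" "z1 < (r + 1) * n" "z2 < (r + 1) * n" "z3 < (r + 1) * n"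
    and "z0 mod n = z1 mod n" "g z1 = g z2" "z2 mod n = z3 mod n" "g z3 = g z0"
  shows "z0 = z1 \<or> z1 = z2"
proof -
  have "n > 0"
    using assms(1) by (cases n) auto
  then have top: "z1 mod n < n" "z2 mod n < n"
    by simp_all
  have "(f ^^ e (z1 div n)) (z1 mod n) = (f ^^ e (z2 div n)) (z2 mod n)"
    using assms(6) unfolding g_def .
  moreover have "(f ^^ e (z3 div n)) (z2 mod n) = (f ^^ e (z0 div n)) (z1 mod n)"
    using assms(8) unfolding g_def assms(5,7) .
  ultimately have "e (z0 div n) = e (z1 div n) \<or>
      e (z1 div n) = e (z2 div n) \<and> z1 mod n = z2 mod n"
    by (rule B2_closed_walk_4[OF B2 cyc assms(1-4)[THEN column_exponent] top])
  then show ?thesis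
    using column_eqI[OF assms(1,2,5)] column_eqI[OF assms(2,3)] by blast
qed

section \<open>Lower bound: no cycles of length 4, 6, 8 or 10\<close>

lemma has_cycle_ge_6:
  assumes "has_cycle (two_row_matrix n f r i) k"
  shows "k \<ge> 6"
proof (rule ccontr)
  assume "\<not> k \<ge> 6"
  moreover have "k > 1"
    using assms by (simp add: has_cycle_def)
  ultimately have "k \<in> {2, 3, 4, 5}"
    by auto
  obtain x y where dist: "distinct (cycle_positions k x y)"
    and ones: "\<And>a b. (a, b) \<in> set (cycle_positions k x y) \<Longrightarrow>
      a < 2 * n \<and> b < (r + 1) * n \<and> two_row_matrix n f r i $$ (a, b) = 1"
    using assms unfolding has_cycle_def two_row_matrix_dims by blast
  have pos: "(x j, y j) \<in> set (cycle_positions k x y)"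
    "(x (Suc j mod k), y j) \<in> set (cycle_positions k x y)" if "j < k" for j
    using that unfolding cycle_positions_def by auto
  have y: "y j < (r + 1) * n" if "j < k" for j
    using ones pos(1)[OF that] by blast
  have "n > 0"
    using y[of 0] \<open>k > 1\<close> by (cases n) auto
  have inc: "x j = y j mod n \<or> x j = n + g (y j)"
    "x (Suc j mod k) = y j mod n \<or> x (Suc j mod k) = n + g (y j)" if "j < k" for j
    using ones[OF pos(1)[OF that]] ones[OF pos(2)[OF that]] one_in_column_iff by blast+
  have top: "y j mod n < n" for j
    using \<open>n > 0\<close> by simp
  \<comment> \<open>The two positions of step \<open>j\<close> share the column \<open>y j\<close>,
    so distinctness separates their rows.\<close>
  have neq: "x j \<noteq> x (Suc j mod k)" if "j < k" for j
  proof -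
    have "[(x j, y j), (x (Suc j mod k), y j)] \<in>
        set (map (\<lambda>j. [(x j, y j), (x (Suc j mod k), y j)]) [0..<k])"
      using that by auto
    then have "distinct [(x j, y j), (x (Suc j mod k), y j)]"
      using dist unfolding cycle_positions_def distinct_concat_iff by blast
    then show ?thesis
      by simp
  qed
  have top_bot: "x (Suc j mod k) \<ge> n \<and> y j mod n = x j \<and> n + g (y j) = x (Suc j mod k)"
    if "j < k" "x j < n" for j
    using inc[OF that(1)] neq[OF that(1)] that(2) by auto
  have bot_top: "x (Suc j mod k) < n \<and> y j mod n = x (Suc j mod k) \<and> n + g (y j) = x j"
    if "j < k" "\<not> x j < n" for j
    using inc[OF that(1)] neq[OF that(1)] that(2) top[of j] by auto
  \<comment> \<open>Each step switches the block row, so a closed walk has an even number of steps;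
    this settles \<open>k = 3\<close> and \<open>k = 5\<close>.\<close>
  have flip: "x (Suc j mod k) < n \<longleftrightarrow> \<not> x j < n" if "j < k" for j
    using top_bot[OF that] bot_top[OF that] by (meson leD)
  from \<open>k \<in> {2, 3, 4, 5}\<close> consider "k = 2" | "k = 3" | "k = 4" | "k = 5"
    by auto
  then show False
  proof cases
    case 1
    have "y 0 \<noteq> y 1"
      using dist by (auto simp: 1 cycle_positions_def upt_rec)
    moreover have idx: "Suc 0 mod 2 = 1" "Suc 1 mod 2 = 0"
      by simp_all
    have "y 0 mod n = y 1 mod n \<and> n + g (y 0) = n + g (y 1)"
    proof (cases "x 0 < n")
      case True
      then show ?thesis
        using top_bot[of 0] bot_top[of 1] flip[of 0] unfolding 1 idx by auto
    next
      case False
      then show ?thesis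
        using bot_top[of 0] top_bot[of 1] flip[of 0] unfolding 1 idx by auto
    qed
    ultimately show False
      using columns_no_double_edge y[of 0] y[of 1] by (auto simp: 1)
  next
    case 2
    have idx: "Suc 0 mod 3 = 1" "Suc 1 mod 3 = 2" "Suc 2 mod 3 = 0"
      by simp_all
    show False
      using flip[of 0] flip[of 1] flip[of 2] unfolding 2 idx by simp
  next
    case 3
    have idx: "Suc 0 mod 4 = 1" "Suc 1 mod 4 = 2" "Suc 2 mod 4 = 3" "Suc 3 mod 4 = 0"
      "[0..<4] = [0, 1, 2, 3]"
      by (simp_all add: upt_rec)
    have y_neq: "y 0 \<noteq> y 1" "y 1 \<noteq> y 2" "y 2 \<noteq> y 3" "y 3 \<noteq> y 0"
      using dist unfolding 3 cycle_positions_def idx list.map idx by auto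
    have size: "y j < (r + 1) * n" if "j \<in> {0, 1, 2, 3}" for j
      using that y by (auto simp: 3)
    show False
    \<comment> \<open>A walk starting in the upper block row is read from \<open>y 3\<close> on, so
      that in both cases the first two columns share their upper one.\<close>
    proof (cases "x 0 < n")
      case True
      then have x: "x 0 < n" "\<not> x 1 < n" "x 2 < n" "\<not> x 3 < n"
        using flip[of 0] flip[of 1] flip[of 2] unfolding 3 idx by auto
      have eq: "y 3 mod n = y 0 mod n" "g (y 0) = g (y 1)"
          "y 1 mod n = y 2 mod n" "g (y 2) = g (y 3)"
        using x top_bot[of 0] bot_top[of 1] top_bot[of 2] bot_top[of 3] unfolding 3 idx by auto
      show False
        using columns_no_4_cycle[OF _ _ _ _ eq] size y_neq by auto
    next
      case False
      then have x: "\<not> x 0 < n" "x 1 < n" "\<not> x 2 < n" "x 3 < n"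
        using flip[of 0] flip[of 1] flip[of 2] unfolding 3 idx by auto
      have eq: "y 0 mod n = y 1 mod n" "g (y 1) = g (y 2)"
          "y 2 mod n = y 3 mod n" "g (y 3) = g (y 0)"
        using x bot_top[of 0] top_bot[of 1] bot_top[of 2] top_bot[of 3] unfolding 3 idx by auto
      show False
        using columns_no_4_cycle[OF _ _ _ _ eq] size y_neq by auto
    qed
  next
    case 4
    have idx: "Suc 0 mod 5 = 1" "Suc 1 mod 5 = 2" "Suc 2 mod 5 = 3" "Suc 3 mod 5 = 4"
        "Suc 4 mod 5 = 0"
      by simp_all
    show False
      using flip[of 0] flip[of 1] flip[of 2] flip[of 3] flip[of 4] unfolding 4 idx by simp
  qed
qed

section \<open>Upper bound: a cycle of length 12\<close>

lemma has_cycle_6: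
  assumes "r \<ge> 2"
  shows "has_cycle (two_row_matrix n f r i) 6"
proof -
  have I: "e v < n" if "v \<le> r" for v
    using that B2 unfolding B2_set_def by fastforce
  then have n: "n > 0"
    by (metis gr_zeroI le0 not_less0)
  \<comment> \<open>Labelling points by exponents turns powers of \<open>f\<close> into translations
    modulo \<open>n\<close>.\<close>
  define P where "P k = (f ^^ k) 0" for k
  have Pn: "P k < n" for k
    using cyclic_on_funpow_in[OF cyc, of 0 k] n by (simp add: P_def)
  have P_eq_iff: "P a = P b \<longleftrightarrow> [a = b] (mod n)" for a b
    using cyclic_on_funpow_eq_iff[OF cyc, of 0 a b] n by (simp add: P_def)
  have fP: "(f ^^ a) (P b) = P (a + b)" for a b
    by (simp add: P_def funpow_add)
  define a b where "a = e 1" and "b = e 2"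
  have e0: "e 0 = 0"
    by (simp add: e_def)
  have ab: "a < n" "b < n" "a \<noteq> b" "a \<noteq> 0" "b \<noteq> 0"
    using I[of 1] I[of 2] inj_onD[OF inj, of 1 2] inj_onD[OF inj, of 1 0] inj_onD[OF inj, of 2 0]
      assms by (auto simp: a_def b_def e0)
  have P_neq: "P a \<noteq> P b" "P a \<noteq> P 0" "P b \<noteq> P 0"
    using ab by (auto simp: P_eq_iff cong_def)
  \<comment> \<open>The edges of this hexagon have exponents \<open>0, a, b, 0, a, b\<close> in
    turn, with alternating sum zero.\<close>
  define x where "x = (!) [P a, n + P a, P 0, n + P b, P b, n + P (a + b)]"
  define y where "y = (!) [P a, n + P 0, 2 * n + P 0, P b, n + P b, 2 * n + P a]"
  have pos: "cycle_positions 6 x y =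
    [(P a, P a), (n + P a, P a), (n + P a, n + P 0), (P 0, n + P 0),
     (P 0, 2 * n + P 0), (n + P b, 2 * n + P 0), (n + P b, P b), (P b, P b),
     (P b, n + P b), (n + P (a + b), n + P b), (n + P (a + b), 2 * n + P a), (P a, 2 * n + P a)]"
    by (simp add: cycle_positions_def x_def y_def upt_rec)
  \<comment> \<open>The six columns differ: each block column holds two of the distinct offsets
    \<open>P 0\<close>, \<open>P a\<close>, \<open>P b\<close>. Within a column the two rows lie in
    different block rows, so \<open>P (a + b)\<close> need not be compared with the others.\<close>
  have "distinct (cycle_positions 6 x y)"
    unfolding pos using P_neq Pn[of a] Pn[of b] Pn[of 0] by auto
  moreover have size: "v * n + P k < (r + 1) * n" if "v \<le> 2" for v k
  proof -
    have "v * n + P k < (v + 1) * n"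
      using Pn[of k] by simp
    also have "\<dots> \<le> (r + 1) * n"
      using that assms by (intro mult_right_mono) auto
    finally show ?thesis .
  qed
  have g: "g (v * n + P k) = P (e v + k)" for v k
    using Pn[of k] by (simp add: g_def fP)
  define valid where "valid p q \<longleftrightarrow>
    p < 2 * n \<and> q < (r + 1) * n \<and> two_row_matrix n f r i $$ (p, q) = 1" for p q
  have valid: "valid (P k) (v * n + P k)" "valid (n + P (e v + k)) (v * n + P k)"
    if "v \<le> 2" for v k
    using size[OF that, of k] Pn[of k] Pn[of "e v + k"]
    by (simp_all add: valid_def one_in_column_iff g del: One_nat_def)
  have "valid (P k) (P k)" "valid (n + P k) (P k)" "valid (P k) (n + P k)"
    "valid (n + P (a + k)) (n + P k)" "valid (P k) (2 * n + P k)"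
    "valid (n + P (b + k)) (2 * n + P k)" for k
    using valid[of 0 k] valid[of 1 k] valid[of 2 k] by (simp_all add: e0 a_def b_def)
  \<comment> \<open>Rewriting \<open>b + a\<close> as \<open>a + b\<close> identifies the two routes
    to the lower vertex \<open>P (a + b)\<close> and closes the hexagon.\<close>
  note this this(4)[of 0] this(6)[of 0] this(6)[of a, unfolded add.commute[of b a]]
  then have "\<forall>(p, q) \<in> set (cycle_positions 6 x y). valid p q"
    unfolding pos by simp
  ultimately show ?thesis
    unfolding has_cycle_def two_row_matrix_dims valid_def by auto
qed

end

section \<open>Computing the girth\<close>

lemma girth_eqI:
  assumes "has_cycle H k" "\<And>l. has_cycle H l \<Longrightarrow> k \<le> l"
  shows "girth H = enat (2 * k)"
  unfolding girth_def by (rule Inf_eqI) (use assms in auto)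

theorem corollary3:
  fixes m n r :: nat
    and f :: "nat \<Rightarrow> nat"
    and i :: "nat \<Rightarrow> nat"
  assumes "m = n" and "prime n"
    and "f permutes {0..<n}" and "cyclic_on f {0..<n}"
    and "r \<ge> 2"
    and "\<And>j. j \<in> {1..r} \<Longrightarrow> i j < m \<and> i j \<noteq> 0"
    and "inj_on i {1..r}"
    and "B2_set m (insert 0 (i ` {1..r}))"
  shows "girth (two_row_matrix n f r i) = 12"
proof -
  \<comment> \<open>The value \<open>i 0\<close> is unconstrained; \<open>e\<close> replaces it by
    \<open>0\<close>, the exponent of the identity block.\<close>
  define e where "e v = (if v = 0 then 0 else i v)" for v
  have split: "{..r} = insert 0 {1..r}"
    by auto
  have e_eq: "e j = i j" if "j \<in> {1..r}" for j
    using that by (simp add: e_def)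
  then have image: "e ` {1..r} = i ` {1..r}"
    by (rule image_cong[OF refl])
  then have "e ` {..r} = insert 0 (i ` {1..r})"
    unfolding split image_insert by (simp add: e_def)
  then have B2: "B2_set n (e ` {..r})"
    using assms(1,8) by (simp only:)
  have inj: "inj_on e {..r}"
    unfolding split inj_on_insert
  proof
    show "inj_on e {1..r}"
      using assms(7) inj_on_cong[of "{1..r}" e i] e_eq by blast
    have "0 \<notin> i ` {1..r}"
      using assms(6) by force
    then show "e 0 \<notin> e ` ({1..r} - {0})"
      using image by (auto simp: e_def)
  qed
  have "girth (two_row_matrix n f r i) = enat (2 * 6)"
    using has_cycle_6[OF e_def refl assms(4) inj B2 assms(5)]
      has_cycle_ge_6[OF e_def refl assms(4) inj B2]
    by (rule girth_eqI)
  then show ?thesis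
    by (simp add: numeral_eq_enat)
qed

end
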